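(* Let $S$ be a semiring, let $X$ and $Y$ be non-empty sets, and let $S^{(X)}$ and $S^{(Y)}$ be the free $S$-semimodules over $X$ and $Y$. Then the commutative monoids $\hom_S(S^{(X)},S^{(Y)})$ and $S^{X\times(Y)}$ are isomorphic. If moreover $S$ is commutative, then they are isomorphic as $S$-semimodules.
   Context: A semiring $\langle S,+,\cdot,0,1\rangle$: $\langle S,+,0\rangle$ is a commutative monoid, $\langle S,\cdot,1\rangle$ is a monoid, $\cdot$ distributes over $+$ from both sides, and $0\cdot a=0=a\cdot 0$ for all $a$. It is commutative if $\cdot$ is commutative. A (left) $S$-semimodule is a commutative monoid $\langle M,+,0\rangle$ with a scalar multiplication $S\times M\to M$ such that $(ab)x=a(bx)$, $a(x+y)=ax+ay$, $(a+b)x=ax+bx$, $0_S x=0_M=a0_M$, $1x=x$. Right semimodules are defined symmetrically. The statement is written for left semimodules; the right-handed version is its mirror image. $S$-semimodule homomorphisms preserve sums and scalar multiplication. For a set $X$, $S^{(X)}$ is the set of functions $X\to S$ with finite support ($f(x)\neq 0_S$ for only finitely many $x$), with pointwise sum and scalar multiplication; it is the free $S$-semimodule over $X$. $\hom_S(M,N)$ is the set of $S$-semimodule homomorphisms $M\to N$, a commutative monoid under pointwise sum with the zero map as neutral element; if $S$ is commutative it is an $S$-semimodule with $(a\cdot f)(x)=a\cdot f(x)$. $S^{X\times(Y)}$ is the set of all functions $k:X\times Y\to S$ such that for every $x\in X$ the function $k(x,-):Y\to S$ has finite support, with pointwise sum (and pointwise scalar multiplication). *)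

theory Defs
  imports "HOL-Algebra.Module" "HOL-Library.FuncSet"
begin

text \<open>
  Semirings are those of the locale \<^locale>\<open>semiring\<close> of HOL-Algebra (so zero and one may
  coincide). Semimodules reuse the record type \<^type>\<open>module_ext\<close>, whose inherited fields
  \<^const>\<open>mult\<close> and \<^const>\<open>one\<close> have no meaning for a semimodule and are left undefined below.
\<close>

locale semimodule = R?: semiring R + M?: abelian_monoid M
  for R :: "('a, 'm) ring_scheme" (structure) and M :: "('a, 'b, 'n) module_scheme" (structure) +
  assumes smult_closed [simp, intro]:
      "\<lbrakk> a \<in> carrier R; x \<in> carrier M \<rbrakk> \<Longrightarrow> a \<odot>\<^bsub>M\<^esub> x \<in> carrier M"
    and smult_assoc:
      "\<lbrakk> a \<in> carrier R; b \<in> carrier R; x \<in> carrier M \<rbrakk> \<Longrightarrow>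
        (a \<otimes> b) \<odot>\<^bsub>M\<^esub> x = a \<odot>\<^bsub>M\<^esub> (b \<odot>\<^bsub>M\<^esub> x)"
    and smult_r_distr:
      "\<lbrakk> a \<in> carrier R; x \<in> carrier M; y \<in> carrier M \<rbrakk> \<Longrightarrow>
        a \<odot>\<^bsub>M\<^esub> (x \<oplus>\<^bsub>M\<^esub> y) = a \<odot>\<^bsub>M\<^esub> x \<oplus>\<^bsub>M\<^esub> a \<odot>\<^bsub>M\<^esub> y"
    and smult_l_distr:
      "\<lbrakk> a \<in> carrier R; b \<in> carrier R; x \<in> carrier M \<rbrakk> \<Longrightarrow>
        (a \<oplus> b) \<odot>\<^bsub>M\<^esub> x = a \<odot>\<^bsub>M\<^esub> x \<oplus>\<^bsub>M\<^esub> b \<odot>\<^bsub>M\<^esub> x"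
    and smult_l_null [simp]: "x \<in> carrier M \<Longrightarrow> \<zero> \<odot>\<^bsub>M\<^esub> x = \<zero>\<^bsub>M\<^esub>"
    and smult_r_null [simp]: "a \<in> carrier R \<Longrightarrow> a \<odot>\<^bsub>M\<^esub> \<zero>\<^bsub>M\<^esub> = \<zero>\<^bsub>M\<^esub>"
    and smult_one [simp]: "x \<in> carrier M \<Longrightarrow> \<one> \<odot>\<^bsub>M\<^esub> x = x"

text \<open>
  Functions on a carrier set are represented extensionally, i.e. they are \<^const>\<open>undefined\<close>
  outside that set.
\<close>

definition semimodule_hom ::
  "('a, 'm) ring_scheme \<Rightarrow> ('a, 'b, 'n) module_scheme \<Rightarrow> ('a, 'c, 'k) module_scheme \<Rightarrow> ('b \<Rightarrow> 'c) set"
  where "semimodule_hom S M N =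
    {h \<in> carrier M \<rightarrow>\<^sub>E carrier N.
       (\<forall>x\<in>carrier M. \<forall>y\<in>carrier M. h (x \<oplus>\<^bsub>M\<^esub> y) = h x \<oplus>\<^bsub>N\<^esub> h y) \<and>
       (\<forall>a\<in>carrier S. \<forall>x\<in>carrier M. h (a \<odot>\<^bsub>M\<^esub> x) = a \<odot>\<^bsub>N\<^esub> h x)}"

definition semimodule_isomorphic ::
  "('a, 'm) ring_scheme \<Rightarrow> ('a, 'b, 'n) module_scheme \<Rightarrow> ('a, 'c, 'k) module_scheme \<Rightarrow> bool"
  where "semimodule_isomorphic S M N \<longleftrightarrow>
    (\<exists>h \<in> semimodule_hom S M N. bij_betw h (carrier M) (carrier N))"

definition free_semimodule :: "('a, 'm) ring_scheme \<Rightarrow> 'x set \<Rightarrow> ('a, 'x \<Rightarrow> 'a) module"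
  where "free_semimodule S X =
    \<lparr> carrier = {f \<in> X \<rightarrow>\<^sub>E carrier S. finite {x \<in> X. f x \<noteq> \<zero>\<^bsub>S\<^esub>}},
      mult = undefined, one = undefined,
      zero = (\<lambda>x\<in>X. \<zero>\<^bsub>S\<^esub>),
      add = (\<lambda>f g. \<lambda>x\<in>X. f x \<oplus>\<^bsub>S\<^esub> g x),
      smult = (\<lambda>a f. \<lambda>x\<in>X. a \<otimes>\<^bsub>S\<^esub> f x) \<rparr>"

text \<open>
  The additive part is a commutative monoid for every semiring \<open>S\<close>; the scalar multiplication
  is meaningful only for commutative \<open>S\<close>, as otherwise \<open>a \<odot> h\<close> need not be a homomorphism.
\<close>

definition hom_semimodule ::
  "('a, 'm) ring_scheme \<Rightarrow> ('a, 'b, 'n) module_scheme \<Rightarrow> ('a, 'c, 'k) module_scheme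
    \<Rightarrow> ('a, 'b \<Rightarrow> 'c) module"
  where "hom_semimodule S M N =
    \<lparr> carrier = semimodule_hom S M N,
      mult = undefined, one = undefined,
      zero = (\<lambda>x\<in>carrier M. \<zero>\<^bsub>N\<^esub>),
      add = (\<lambda>f g. \<lambda>x\<in>carrier M. f x \<oplus>\<^bsub>N\<^esub> g x),
      smult = (\<lambda>a f. \<lambda>x\<in>carrier M. a \<odot>\<^bsub>N\<^esub> f x) \<rparr>"

definition row_finite_semimodule ::
  "('a, 'm) ring_scheme \<Rightarrow> 'x set \<Rightarrow> 'y set \<Rightarrow> ('a, 'x \<times> 'y \<Rightarrow> 'a) module"
  where "row_finite_semimodule S X Y =
    \<lparr> carrier = {k \<in> X \<times> Y \<rightarrow>\<^sub>E carrier S. \<forall>x\<in>X. finite {y \<in> Y. k (x, y) \<noteq> \<zero>\<^bsub>S\<^esub>}},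
      mult = undefined, one = undefined,
      zero = (\<lambda>p\<in>X \<times> Y. \<zero>\<^bsub>S\<^esub>),
      add = (\<lambda>k l. \<lambda>p\<in>X \<times> Y. k p \<oplus>\<^bsub>S\<^esub> l p),
      smult = (\<lambda>a k. \<lambda>p\<in>X \<times> Y. a \<otimes>\<^bsub>S\<^esub> k p) \<rparr>"

text \<open>For commutative \<open>S\<close> all three structures are semimodules; in general, the two on functions
  into \<open>S\<close> are semimodules and the one on homomorphisms is a commutative monoid.\<close>

lemma funcset_ext_mem: "f \<in> A \<rightarrow>\<^sub>E B \<Longrightarrow> x \<in> A \<Longrightarrow> f x \<in> B"
  by (rule PiE_mem)

lemma restrict_eq_ext:
  assumes "g \<in> A \<rightarrow>\<^sub>E B" "\<And>x. x \<in> A \<Longrightarrow> f x = g x"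
  shows "restrict f A = g"
  using assms(2) PiE_arb[OF assms(1)] by (simp add: fun_eq_iff restrict_def)

lemma Collect_imp_mem: "{x. (x \<in> A \<longrightarrow> P x) \<and> x \<in> A} = {x \<in> A. P x}"
  by auto

lemma semimodule_free_semimodule:
  assumes "semiring S"
  shows "semimodule S (free_semimodule S X)" (is "semimodule S ?M")
proof -
  interpret S: semiring S by fact
  have fin_add: "finite {x \<in> X. f x \<oplus>\<^bsub>S\<^esub> g x \<noteq> \<zero>\<^bsub>S\<^esub>}"
    if "finite {x \<in> X. f x \<noteq> \<zero>\<^bsub>S\<^esub>}" "finite {x \<in> X. g x \<noteq> \<zero>\<^bsub>S\<^esub>}" for f g
    by (rule finite_subset[OF _ finite_UnI[OF that]]) auto
  have fin_smult: "finite {x \<in> X. a \<otimes>\<^bsub>S\<^esub> f x \<noteq> \<zero>\<^bsub>S\<^esub>}"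
    if "finite {x \<in> X. f x \<noteq> \<zero>\<^bsub>S\<^esub>}" "a \<in> carrier S" for a f
    by (rule finite_subset[OF _ that(1)]) (use that(2) in auto)
  show ?thesis
  proof (intro semimodule.intro semimodule_axioms.intro abelian_monoidI assms)
    show "(f \<oplus>\<^bsub>?M\<^esub> g) \<oplus>\<^bsub>?M\<^esub> h = f \<oplus>\<^bsub>?M\<^esub> (g \<oplus>\<^bsub>?M\<^esub> h)"
      if "f \<in> carrier ?M" "g \<in> carrier ?M" "h \<in> carrier ?M" for f g h
      using that by (auto simp: free_semimodule_def funcset_ext_mem S.a_assoc intro!: restrict_ext)
  qed (auto simp: free_semimodule_def Collect_imp_mem[of X] fin_add fin_smult funcset_ext_mem
      S.a_comm S.l_distr S.r_distr S.m_assoc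
      intro!: restrict_eq_ext restrict_ext)
qed

lemma semimodule_row_finite_semimodule:
  fixes S :: "('a, 'm) ring_scheme" and X :: "'x set" and Y :: "'y set"
  assumes "semiring S"
  shows "semimodule S (row_finite_semimodule S X Y)" (is "semimodule S ?M")
proof -
  interpret S: semiring S by fact
  have fin_add: "finite {y \<in> Y. f (x, y) \<oplus>\<^bsub>S\<^esub> g (x, y) \<noteq> \<zero>\<^bsub>S\<^esub>}"
    if "finite {y \<in> Y. f (x, y) \<noteq> \<zero>\<^bsub>S\<^esub>}" "finite {y \<in> Y. g (x, y) \<noteq> \<zero>\<^bsub>S\<^esub>}"
    for f g :: "'x \<times> 'y \<Rightarrow> 'a" and x
    by (rule finite_subset[OF _ finite_UnI[OF that]]) auto
  have fin_smult: "finite {y \<in> Y. a \<otimes>\<^bsub>S\<^esub> f (x, y) \<noteq> \<zero>\<^bsub>S\<^esub>}"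
    if "finite {y \<in> Y. f (x, y) \<noteq> \<zero>\<^bsub>S\<^esub>}" "a \<in> carrier S"
    for a and f :: "'x \<times> 'y \<Rightarrow> 'a" and x
    by (rule finite_subset[OF _ that(1)]) (use that(2) in auto)
  show ?thesis
  proof (intro semimodule.intro semimodule_axioms.intro abelian_monoidI assms)
    show "(f \<oplus>\<^bsub>?M\<^esub> g) \<oplus>\<^bsub>?M\<^esub> h = f \<oplus>\<^bsub>?M\<^esub> (g \<oplus>\<^bsub>?M\<^esub> h)"
      if "f \<in> carrier ?M" "g \<in> carrier ?M" "h \<in> carrier ?M" for f g h
      using that by (auto simp: row_finite_semimodule_def funcset_ext_mem S.a_assoc intro!: restrict_ext)
  qed (auto simp: row_finite_semimodule_def Collect_imp_mem[of Y] fin_add fin_smult funcset_ext_mem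
      S.a_comm S.l_distr S.r_distr S.m_assoc
      intro!: restrict_eq_ext restrict_ext)
qed

lemma abelian_monoid_hom_semimodule:
  assumes "semimodule S M" "semimodule S N"
  shows "abelian_monoid (hom_semimodule S M N)"
proof -
  interpret M: semimodule S M by fact
  interpret N: semimodule S N by fact
  show ?thesis
    by (rule abelian_monoidI)
      (auto simp: hom_semimodule_def semimodule_hom_def funcset_ext_mem
        N.M.a_ac N.smult_r_distr
        intro!: restrict_eq_ext restrict_ext)
qed

lemma semimodule_hom_semimodule:
  assumes "semimodule S M" "semimodule S N" "comm_monoid S"
  shows "semimodule S (hom_semimodule S M N)"
proof -
  interpret M: semimodule S M by fact
  interpret N: semimodule S N by fact
  interpret S: comm_monoid S by fact
  have comm: "a \<odot>\<^bsub>N\<^esub> (b \<odot>\<^bsub>N\<^esub> x) = b \<odot>\<^bsub>N\<^esub> (a \<odot>\<^bsub>N\<^esub> x)"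
    if "a \<in> carrier S" "b \<in> carrier S" "x \<in> carrier N" for a b x
    using that by (metis N.smult_assoc S.m_comm)
  show ?thesis
  proof (intro semimodule.intro semimodule_axioms.intro abelian_monoid_hom_semimodule[OF assms(1,2)])
    show "semiring S" ..
    show "a \<odot>\<^bsub>hom_semimodule S M N\<^esub> h \<in> carrier (hom_semimodule S M N)"
      if "a \<in> carrier S" "h \<in> carrier (hom_semimodule S M N)" for a h
      using that by (auto simp: hom_semimodule_def semimodule_hom_def funcset_ext_mem
        N.smult_r_distr comm)
  qed (auto simp: hom_semimodule_def semimodule_hom_def funcset_ext_mem
      N.smult_r_distr N.smult_l_distr N.smult_assoc
      intro!: restrict_eq_ext restrict_ext)
qed

end

theory Submission
  imports Defs
begin

text \<open>
  A homomorphism \<open>h\<close> out of the free semimodule over \<open>X\<close> is determined by the values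
  \<open>h \<delta>\<^sub>x\<close> on the basis vectors
  \<open>\<delta>\<^sub>x\<close> (\<open>basis_vector\<close>), since every \<open>f\<close> is the finite sum of the multiples
  \<open>f x \<odot> \<delta>\<^sub>x\<close>, and these values can be prescribed arbitrarily. This universal property is the
  content of the lemmas \<open>semimodule_hom_eqI\<close> (uniqueness) and \<open>linear_extension_hom\<close> with
  \<open>linear_extension_basis_vector\<close> (existence), for an arbitrary target semimodule \<open>N\<close>.

  For \<open>N = S\<^bsup>(Y)\<^esup>\<close> the values on the basis form a family of finitely supported functions on \<open>Y\<close>
  indexed by \<open>X\<close>, which after uncurrying is the same thing as a row-finite matrix on
  \<open>X \<times> Y\<close>: the row with index \<open>x\<close> is \<open>h \<delta>\<^sub>x\<close>. So the passage from \<open>h\<close> to its matrix is a bijection.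
  It respects sums and scalar multiples because both are computed pointwise on either side.
  Commutativity of \<open>S\<close> enters only to make scalar multiples of homomorphisms homomorphisms again.
\<close>

section \<open>The universal property of free semimodules\<close>

definition basis_vector :: "('a, 'm) ring_scheme \<Rightarrow> 'x set \<Rightarrow> 'x \<Rightarrow> 'x \<Rightarrow> 'a"
  where "basis_vector S X x = (\<lambda>z\<in>X. if z = x then \<one>\<^bsub>S\<^esub> else \<zero>\<^bsub>S\<^esub>)"

definition linear_extension ::
  "('a, 'm) ring_scheme \<Rightarrow> 'x set \<Rightarrow> ('a, 'c, 'k) module_scheme \<Rightarrow> ('x \<Rightarrow> 'c) \<Rightarrow> ('x \<Rightarrow> 'a) \<Rightarrow> 'c"
  where "linear_extension S X N v =
    (\<lambda>f\<in>carrier (free_semimodule S X). \<Oplus>\<^bsub>N\<^esub>x\<in>{x \<in> X. f x \<noteq> \<zero>\<^bsub>S\<^esub>}. f x \<odot>\<^bsub>N\<^esub> v x)"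

lemma basis_vector_closed:
  assumes "semiring S"
  shows "basis_vector S X x \<in> carrier (free_semimodule S X)"
proof -
  interpret S: semiring S by fact
  have "finite {z \<in> X. basis_vector S X x z \<noteq> \<zero>\<^bsub>S\<^esub>}"
    by (rule finite_subset[of _ "{x}"]) (auto simp: basis_vector_def)
  then show ?thesis
    by (simp add: free_semimodule_def) (auto simp: basis_vector_def)
qed

lemma semimodule_hom_zero:
  assumes "semimodule S M" "semimodule S N" "h \<in> semimodule_hom S M N"
  shows "h \<zero>\<^bsub>M\<^esub> = \<zero>\<^bsub>N\<^esub>"
proof -
  interpret M: semimodule S M by fact
  interpret N: semimodule S N by fact
  have h0: "h \<zero>\<^bsub>M\<^esub> \<in> carrier N"
    using assms(3) by (auto simp: semimodule_hom_def)
  \<comment> \<open>Additivity alone does not give this in the absence of cancellation; the scalar zero does.\<close>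
  have "h (\<zero>\<^bsub>S\<^esub> \<odot>\<^bsub>M\<^esub> \<zero>\<^bsub>M\<^esub>) = \<zero>\<^bsub>S\<^esub> \<odot>\<^bsub>N\<^esub> h \<zero>\<^bsub>M\<^esub>"
    using assms(3) by (simp add: semimodule_hom_def del: M.smult_l_null M.smult_r_null)
  then show ?thesis
    using h0 by simp
qed

text \<open>
  Induction on a finite set containing the support: splitting off \<open>f x \<odot> \<delta>\<^sub>x\<close> leaves a
  function with support in a smaller set.
\<close>

lemma semimodule_hom_eq_on_finite_support:
  assumes "semimodule S N"
    and g: "g \<in> semimodule_hom S (free_semimodule S X) N"
    and h: "h \<in> semimodule_hom S (free_semimodule S X) N"
    and basis: "\<And>x. x \<in> X \<Longrightarrow> g (basis_vector S X x) = h (basis_vector S X x)"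
    and "finite A" "f \<in> carrier (free_semimodule S X)" "{x \<in> X. f x \<noteq> \<zero>\<^bsub>S\<^esub>} \<subseteq> A"
  shows "g f = h f"
proof -
  interpret N: semimodule S N by fact
  let ?F = "free_semimodule S X"
  interpret F: semimodule S ?F
    by (rule semimodule_free_semimodule) (rule N.R.semiring_axioms)
  from assms(5-7) show ?thesis
  proof (induction A arbitrary: f rule: finite_induct)
    case empty
    then have "f = \<zero>\<^bsub>?F\<^esub>"
      using restrict_eq_ext[of f X "carrier S" "\<lambda>_. \<zero>\<^bsub>S\<^esub>"]
      by (auto simp: free_semimodule_def)
    then show ?case
      by (simp add: semimodule_hom_zero[OF F.semimodule_axioms assms(1) g]
          semimodule_hom_zero[OF F.semimodule_axioms assms(1) h])
  next
    case (insert x A)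
    show ?case
    proof (cases "x \<in> X")
      case False
      then show ?thesis
        using insert.prems by (intro insert.IH) auto
    next
      case True
      let ?d = "basis_vector S X x"
      let ?r = "f(x := \<zero>\<^bsub>S\<^esub>)"
      have val: "f z \<in> carrier S" if "z \<in> X" for z
        using insert.prems(1) that by (auto simp: free_semimodule_def)
      have "finite {z \<in> X. f z \<noteq> \<zero>\<^bsub>S\<^esub>}"
        using insert.prems(1) by (simp add: free_semimodule_def)
      then have "finite {z \<in> X. ?r z \<noteq> \<zero>\<^bsub>S\<^esub>}"
        by (rule rev_finite_subset) auto
      moreover have "?r \<in> X \<rightarrow>\<^sub>E carrier S"
        using insert.prems(1) True by (auto simp: free_semimodule_def PiE_iff extensional_def)
      ultimately have r: "?r \<in> carrier ?F"
        by (simp only: free_semimodule_def partial_object.simps mem_Collect_eq simp_thms)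
      have d: "?d \<in> carrier ?F"
        by (rule basis_vector_closed) (rule N.R.semiring_axioms)
      have ext: "f z = undefined" if "z \<notin> X" for z
        using insert.prems(1) that by (auto simp: free_semimodule_def PiE_iff extensional_def)
      have split: "f = f x \<odot>\<^bsub>?F\<^esub> ?d \<oplus>\<^bsub>?F\<^esub> ?r"
      proof
        fix z
        show "f z = (f x \<odot>\<^bsub>?F\<^esub> ?d \<oplus>\<^bsub>?F\<^esub> ?r) z"
          using val True ext
          by (cases "z \<in> X") (auto simp: free_semimodule_def basis_vector_def)
      qed
      have apply_hom: "k f = f x \<odot>\<^bsub>N\<^esub> k ?d \<oplus>\<^bsub>N\<^esub> k ?r"
        if "k \<in> semimodule_hom S ?F N" for k
      proof -
        have "k f = k (f x \<odot>\<^bsub>?F\<^esub> ?d \<oplus>\<^bsub>?F\<^esub> ?r)"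
          using split by simp
        also have "\<dots> = f x \<odot>\<^bsub>N\<^esub> k ?d \<oplus>\<^bsub>N\<^esub> k ?r"
          using that d r val[OF True] by (simp add: semimodule_hom_def)
        finally show ?thesis .
      qed
      have "g ?r = h ?r"
        using insert.prems(2) by (intro insert.IH[OF r]) auto
      then show ?thesis
        using apply_hom[OF g] apply_hom[OF h] basis[OF True] by simp
    qed
  qed
qed

lemma semimodule_hom_eqI:
  assumes "semimodule S N"
    and g: "g \<in> semimodule_hom S (free_semimodule S X) N"
    and h: "h \<in> semimodule_hom S (free_semimodule S X) N"
    and basis: "\<And>x. x \<in> X \<Longrightarrow> g (basis_vector S X x) = h (basis_vector S X x)"
  shows "g = h"
proof (rule PiE_ext)
  show "g \<in> carrier (free_semimodule S X) \<rightarrow>\<^sub>E carrier N"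
    "h \<in> carrier (free_semimodule S X) \<rightarrow>\<^sub>E carrier N"
    using g h by (auto simp: semimodule_hom_def)
  show "g f = h f" if "f \<in> carrier (free_semimodule S X)" for f
    by (rule semimodule_hom_eq_on_finite_support[OF assms _ that subset_refl])
      (use that in \<open>auto simp: free_semimodule_def\<close>)
qed

lemma (in semimodule) smult_finsum:
  assumes "finite A" "a \<in> carrier R" "v \<in> A \<rightarrow> carrier M"
  shows "a \<odot>\<^bsub>M\<^esub> (\<Oplus>\<^bsub>M\<^esub>x\<in>A. v x) = (\<Oplus>\<^bsub>M\<^esub>x\<in>A. a \<odot>\<^bsub>M\<^esub> v x)"
  using assms
proof (induction A rule: finite_induct)
  case (insert x A)
  then have "v x \<in> carrier M" "v \<in> A \<rightarrow> carrier M" "(\<lambda>x. a \<odot>\<^bsub>M\<^esub> v x) \<in> A \<rightarrow> carrier M"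
    by auto
  with insert show ?case
    by (simp add: smult_r_distr)
qed simp

text \<open>
  Functions with different supports can only be added termwise over a common index set, hence the
  freedom to sum over any finite superset of the support.
\<close>

lemma linear_extension_eq_finsum:
  assumes "semimodule S N" "v \<in> X \<rightarrow> carrier N" "f \<in> carrier (free_semimodule S X)"
    and "finite A" "A \<subseteq> X" "{x \<in> X. f x \<noteq> \<zero>\<^bsub>S\<^esub>} \<subseteq> A"
  shows "linear_extension S X N v f = (\<Oplus>\<^bsub>N\<^esub>x\<in>A. f x \<odot>\<^bsub>N\<^esub> v x)"
proof -
  interpret N: semimodule S N by fact
  have val: "f x \<in> carrier S" if "x \<in> X" for x
    using assms(3) that by (auto simp: free_semimodule_def)
  have "(\<Oplus>\<^bsub>N\<^esub>x\<in>{x \<in> X. f x \<noteq> \<zero>\<^bsub>S\<^esub>}. f x \<odot>\<^bsub>N\<^esub> v x) = (\<Oplus>\<^bsub>N\<^esub>x\<in>A. f x \<odot>\<^bsub>N\<^esub> v x)"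
    using assms(2,4-6) val
    by (intro N.M.add.finprod_mono_neutral_cong_left) (auto simp: Pi_def subset_iff)
  then show ?thesis
    using assms(3) by (simp add: linear_extension_def)
qed

lemma linear_extension_hom:
  assumes "semimodule S N" and v: "v \<in> X \<rightarrow> carrier N"
  shows "linear_extension S X N v \<in> semimodule_hom S (free_semimodule S X) N"
proof -
  interpret N: semimodule S N by fact
  let ?F = "free_semimodule S X"
  let ?L = "linear_extension S X N v"
  interpret F: semimodule S ?F
    by (rule semimodule_free_semimodule) (rule N.R.semiring_axioms)
  have val: "f x \<in> carrier S" if "f \<in> carrier ?F" "x \<in> X" for f x
    using that by (auto simp: free_semimodule_def)
  have fin: "finite {x \<in> X. f x \<noteq> \<zero>\<^bsub>S\<^esub>}" if "f \<in> carrier ?F" for f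
    using that by (simp add: free_semimodule_def)
  have vc: "v x \<in> carrier N" if "x \<in> X" for x
    using v that by auto
  note L = linear_extension_eq_finsum[OF assms]
  have "?L f \<in> carrier N" if "f \<in> carrier ?F" for f
    using L[OF that fin[OF that]] val[OF that] vc by (auto intro!: N.M.finsum_closed)
  then have "?L \<in> carrier ?F \<rightarrow>\<^sub>E carrier N"
    by (auto simp: linear_extension_def)
  moreover have "?L (f \<oplus>\<^bsub>?F\<^esub> g) = ?L f \<oplus>\<^bsub>N\<^esub> ?L g"
    if f: "f \<in> carrier ?F" and g: "g \<in> carrier ?F" for f g
  proof -
    let ?A = "{x \<in> X. f x \<noteq> \<zero>\<^bsub>S\<^esub>} \<union> {x \<in> X. g x \<noteq> \<zero>\<^bsub>S\<^esub>}"
    have A: "finite ?A" "?A \<subseteq> X"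
      using fin[OF f] fin[OF g] by auto
    have fg: "(f \<oplus>\<^bsub>?F\<^esub> g) x = f x \<oplus>\<^bsub>S\<^esub> g x" if "x \<in> X" for x
      using that by (simp add: free_semimodule_def)
    have "?L (f \<oplus>\<^bsub>?F\<^esub> g) = (\<Oplus>\<^bsub>N\<^esub>x\<in>?A. (f \<oplus>\<^bsub>?F\<^esub> g) x \<odot>\<^bsub>N\<^esub> v x)"
      using f g A fg by (intro L) auto
    also have "\<dots> = (\<Oplus>\<^bsub>N\<^esub>x\<in>?A. f x \<odot>\<^bsub>N\<^esub> v x \<oplus>\<^bsub>N\<^esub> g x \<odot>\<^bsub>N\<^esub> v x)"
      using val[OF f] val[OF g] vc fg
      by (intro N.M.add.finprod_cong') (auto simp: N.smult_l_distr)
    also have "\<dots> = (\<Oplus>\<^bsub>N\<^esub>x\<in>?A. f x \<odot>\<^bsub>N\<^esub> v x) \<oplus>\<^bsub>N\<^esub> (\<Oplus>\<^bsub>N\<^esub>x\<in>?A. g x \<odot>\<^bsub>N\<^esub> v x)"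
      using val[OF f] val[OF g] vc by (intro N.M.finsum_addf) auto
    also have "\<dots> = ?L f \<oplus>\<^bsub>N\<^esub> ?L g"
      using L[OF f A] L[OF g A] by simp
    finally show ?thesis .
  qed
  moreover have "?L (a \<odot>\<^bsub>?F\<^esub> f) = a \<odot>\<^bsub>N\<^esub> ?L f"
    if a: "a \<in> carrier S" and f: "f \<in> carrier ?F" for a f
  proof -
    let ?A = "{x \<in> X. f x \<noteq> \<zero>\<^bsub>S\<^esub>}"
    have A: "finite ?A" "?A \<subseteq> X"
      using fin[OF f] by auto
    have af: "(a \<odot>\<^bsub>?F\<^esub> f) x = a \<otimes>\<^bsub>S\<^esub> f x" if "x \<in> X" for x
      using that by (simp add: free_semimodule_def)
    have "?L (a \<odot>\<^bsub>?F\<^esub> f) = (\<Oplus>\<^bsub>N\<^esub>x\<in>?A. (a \<odot>\<^bsub>?F\<^esub> f) x \<odot>\<^bsub>N\<^esub> v x)"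
      using a f A af by (intro L) auto
    also have "\<dots> = (\<Oplus>\<^bsub>N\<^esub>x\<in>?A. a \<odot>\<^bsub>N\<^esub> (f x \<odot>\<^bsub>N\<^esub> v x))"
      using a val[OF f] vc af
      by (intro N.M.add.finprod_cong') (auto simp: N.smult_assoc)
    also have "\<dots> = a \<odot>\<^bsub>N\<^esub> ?L f"
      using a val[OF f] vc A L[OF f A] by (subst N.smult_finsum[symmetric]) auto
    finally show ?thesis .
  qed
  ultimately show ?thesis
    by (simp add: semimodule_hom_def)
qed

lemma linear_extension_basis_vector:
  assumes "semimodule S N" and v: "v \<in> X \<rightarrow> carrier N" and x: "x \<in> X"
  shows "linear_extension S X N v (basis_vector S X x) = v x"
proof -
  interpret N: semimodule S N by fact
  have vx: "v x \<in> carrier N"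
    using v x by auto
  \<comment> \<open>\<open>{x}\<close> contains the support but need not equal it: in the zero semiring \<open>\<delta>\<^sub>x\<close> vanishes.\<close>
  have "linear_extension S X N v (basis_vector S X x)
      = (\<Oplus>\<^bsub>N\<^esub>z\<in>{x}. basis_vector S X x z \<odot>\<^bsub>N\<^esub> v z)"
    using x by (intro linear_extension_eq_finsum[OF assms(1) v] basis_vector_closed
        N.R.semiring_axioms) (auto simp: basis_vector_def)
  also have "\<dots> = \<one>\<^bsub>S\<^esub> \<odot>\<^bsub>N\<^esub> v x \<oplus>\<^bsub>N\<^esub> \<zero>\<^bsub>N\<^esub>"
    using vx x by (subst N.M.finsum_insert) (auto simp: basis_vector_def)
  also have "\<dots> = v x"
    using vx by simp
  finally show ?thesis .
qed

section \<open>Homomorphisms of free semimodules as row-finite matrices\<close>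

text \<open>
  The matrix of \<open>h\<close> has \<open>h \<delta>\<^sub>x\<close> as its row with index \<open>x\<close>. The restriction to homomorphisms makes
  the assignment itself extensional, so that it can be a semimodule homomorphism in turn.
\<close>

definition matrix_of_hom ::
  "('a, 'm) ring_scheme \<Rightarrow> 'x set \<Rightarrow> 'y set \<Rightarrow> (('x \<Rightarrow> 'a) \<Rightarrow> ('y \<Rightarrow> 'a)) \<Rightarrow> 'x \<times> 'y \<Rightarrow> 'a"
  where "matrix_of_hom S X Y =
    (\<lambda>h\<in>semimodule_hom S (free_semimodule S X) (free_semimodule S Y).
      \<lambda>(x, y)\<in>X \<times> Y. h (basis_vector S X x) y)"

text \<open>
  Injectivity is uniqueness in the universal property, since the rows of the matrix are the values
  on the basis vectors. For surjectivity the rows of \<open>k\<close>, which row-finiteness puts into the free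
  semimodule over \<open>Y\<close>, are extended linearly.
\<close>

lemma bij_betw_matrix_of_hom:
  assumes "semiring S"
  shows "bij_betw (matrix_of_hom S X Y)
    (semimodule_hom S (free_semimodule S X) (free_semimodule S Y))
    (carrier (row_finite_semimodule S X Y))"
proof -
  let ?F = "free_semimodule S X" and ?G = "free_semimodule S Y"
  let ?H = "semimodule_hom S ?F ?G" and ?K = "carrier (row_finite_semimodule S X Y)"
  note G = semimodule_free_semimodule[OF assms, of Y]
  have row: "h (basis_vector S X x) \<in> carrier ?G" if "h \<in> ?H" for h x
    using that by (auto simp: semimodule_hom_def intro: PiE_mem basis_vector_closed[OF assms])
  have closed: "matrix_of_hom S X Y h \<in> ?K" if "h \<in> ?H" for h
    using row[OF that] that
    by (auto simp: matrix_of_hom_def row_finite_semimodule_def free_semimodule_def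
        Collect_imp_mem PiE_iff cong: conj_cong)
  show ?thesis
    unfolding bij_betw_def
  proof (intro conjI equalityI subsetI)
    show "inj_on (matrix_of_hom S X Y) ?H"
    proof (rule inj_onI)
      fix g h
      assume g: "g \<in> ?H" and h: "h \<in> ?H"
        and eq: "matrix_of_hom S X Y g = matrix_of_hom S X Y h"
      show "g = h"
      proof (rule semimodule_hom_eqI[OF G g h])
        fix x assume x: "x \<in> X"
        show "g (basis_vector S X x) = h (basis_vector S X x)"
        proof (rule PiE_ext)
          show "g (basis_vector S X x) \<in> Y \<rightarrow>\<^sub>E carrier S"
            "h (basis_vector S X x) \<in> Y \<rightarrow>\<^sub>E carrier S"
            using row[OF g, of x] row[OF h, of x] by (auto simp: free_semimodule_def)
          show "g (basis_vector S X x) y = h (basis_vector S X x) y" if "y \<in> Y" for y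
            using fun_cong[OF eq, of "(x, y)"] g h x that by (simp add: matrix_of_hom_def)
        qed
      qed
    qed
  next
    show "k \<in> ?K" if "k \<in> matrix_of_hom S X Y ` ?H" for k
      using that closed by auto
  next
    fix k assume k: "k \<in> ?K"
    let ?v = "\<lambda>x. \<lambda>y\<in>Y. k (x, y)"
    let ?h = "linear_extension S X ?G ?v"
    have v: "?v \<in> X \<rightarrow> carrier ?G"
      using k by (auto simp: row_finite_semimodule_def free_semimodule_def
          Collect_imp_mem PiE_iff cong: conj_cong)
    have h: "?h \<in> ?H"
      by (rule linear_extension_hom[OF G v])
    have "matrix_of_hom S X Y ?h = k"
    proof (rule PiE_ext)
      show "matrix_of_hom S X Y ?h \<in> X \<times> Y \<rightarrow>\<^sub>E carrier S" "k \<in> X \<times> Y \<rightarrow>\<^sub>E carrier S"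
        using closed[OF h] k by (auto simp: row_finite_semimodule_def)
      show "matrix_of_hom S X Y ?h p = k p" if "p \<in> X \<times> Y" for p
        using that h linear_extension_basis_vector[OF G v]
        by (auto simp: matrix_of_hom_def)
    qed
    then show "k \<in> matrix_of_hom S X Y ` ?H"
      using h by (rule image_eqI[OF sym])
  qed
qed

lemma matrix_of_hom_add:
  assumes "semiring S"
    and "g \<in> carrier (hom_semimodule S (free_semimodule S X) (free_semimodule S Y))"
    and "h \<in> carrier (hom_semimodule S (free_semimodule S X) (free_semimodule S Y))"
  shows "matrix_of_hom S X Y
      (g \<oplus>\<^bsub>hom_semimodule S (free_semimodule S X) (free_semimodule S Y)\<^esub> h)
    = matrix_of_hom S X Y g \<oplus>\<^bsub>row_finite_semimodule S X Y\<^esub> matrix_of_hom S X Y h"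
proof -
  let ?F = "free_semimodule S X" and ?G = "free_semimodule S Y"
  let ?H = "hom_semimodule S ?F ?G"
  interpret H: abelian_monoid ?H
    by (intro abelian_monoid_hom_semimodule semimodule_free_semimodule assms(1))
  have carr: "carrier ?H = semimodule_hom S ?F ?G"
    by (simp add: hom_semimodule_def)
  have "g \<oplus>\<^bsub>?H\<^esub> h \<in> semimodule_hom S ?F ?G"
    using H.a_closed[OF assms(2,3)] carr by simp
  moreover have "(g \<oplus>\<^bsub>?H\<^esub> h) (basis_vector S X x) y
      = g (basis_vector S X x) y \<oplus>\<^bsub>S\<^esub> h (basis_vector S X x) y" if "y \<in> Y" for x y
    using that basis_vector_closed[OF assms(1), of X x]
    by (simp add: hom_semimodule_def free_semimodule_def[of S Y])
  ultimately show ?thesis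
    using assms(2,3)
    by (auto simp: carr matrix_of_hom_def row_finite_semimodule_def fun_eq_iff)
qed

text \<open>
  Without commutativity the left-hand side below need not make sense: \<open>a \<odot> h\<close> might not be a
  homomorphism.
\<close>

lemma matrix_of_hom_smult:
  assumes "semiring S" "comm_monoid S" "a \<in> carrier S"
    and "h \<in> carrier (hom_semimodule S (free_semimodule S X) (free_semimodule S Y))"
  shows "matrix_of_hom S X Y
      (a \<odot>\<^bsub>hom_semimodule S (free_semimodule S X) (free_semimodule S Y)\<^esub> h)
    = a \<odot>\<^bsub>row_finite_semimodule S X Y\<^esub> matrix_of_hom S X Y h"
proof -
  let ?F = "free_semimodule S X" and ?G = "free_semimodule S Y"
  let ?H = "hom_semimodule S ?F ?G"
  interpret H: semimodule S ?H
    by (intro semimodule_hom_semimodule semimodule_free_semimodule assms(1,2))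
  have carr: "carrier ?H = semimodule_hom S ?F ?G"
    by (simp add: hom_semimodule_def)
  have "a \<odot>\<^bsub>?H\<^esub> h \<in> semimodule_hom S ?F ?G"
    using H.smult_closed[OF assms(3,4)] carr by simp
  moreover have "(a \<odot>\<^bsub>?H\<^esub> h) (basis_vector S X x) y = a \<otimes>\<^bsub>S\<^esub> h (basis_vector S X x) y"
    if "y \<in> Y" for x y
    using that basis_vector_closed[OF assms(1), of X x]
    by (simp add: hom_semimodule_def free_semimodule_def[of S Y])
  ultimately show ?thesis
    using assms(4)
    by (auto simp: carr matrix_of_hom_def row_finite_semimodule_def fun_eq_iff)
qed

theorem theorem2p15:
  fixes S :: "('a, 'm) ring_scheme" and X :: "'x set" and Y :: "'y set"
  assumes "semiring S" and "X \<noteq> {}" and "Y \<noteq> {}"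
  shows "add_monoid (hom_semimodule S (free_semimodule S X) (free_semimodule S Y))
           \<cong> add_monoid (row_finite_semimodule S X Y)
       \<and> (comm_monoid S \<longrightarrow>
           semimodule_isomorphic S
             (hom_semimodule S (free_semimodule S X) (free_semimodule S Y))
             (row_finite_semimodule S X Y))"
proof -
  let ?H = "hom_semimodule S (free_semimodule S X) (free_semimodule S Y)"
  let ?K = "row_finite_semimodule S X Y"
  let ?m = "matrix_of_hom S X Y"
  have carr: "carrier ?H = semimodule_hom S (free_semimodule S X) (free_semimodule S Y)"
    by (simp add: hom_semimodule_def)
  have bij: "bij_betw ?m (carrier ?H) (carrier ?K)"
    using bij_betw_matrix_of_hom[OF assms(1)] by (simp add: carr)
  then have closed: "?m \<in> carrier ?H \<rightarrow> carrier ?K"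
    by (rule bij_betw_imp_funcset)
  note add = matrix_of_hom_add[OF assms(1)]
  have "?m \<in> iso (add_monoid ?H) (add_monoid ?K)"
    using bij closed by (auto simp: iso_def hom_def add)
  then have "add_monoid ?H \<cong> add_monoid ?K"
    by (rule is_isoI)
  moreover have "semimodule_isomorphic S ?H ?K" if "comm_monoid S"
  proof -
    have "?m \<in> carrier ?H \<rightarrow>\<^sub>E carrier ?K"
      using closed by (auto simp: PiE_def carr matrix_of_hom_def)
    then have "?m \<in> semimodule_hom S ?H ?K"
      by (simp add: semimodule_hom_def[of S ?H] add matrix_of_hom_smult[OF assms(1) that])
    then show ?thesis
      using bij by (auto simp: semimodule_isomorphic_def)
  qed
  ultimately show ?thesis
    by blast
qed

end
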